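(* Let $\mathfrak{B}$ be a Boolean algebra, $\mathbf{d}\in B$ non-zero, and define $x\mathrel{\mathsf{C}_{\mathbf{d}}} y$ iff $x\cdot y\neq\mathsf{0}$ or ($x\cdot\mathbf{d}\neq\mathsf{0}$ and $y\cdot\mathbf{d}\neq\mathsf{0}$). Then the contact algebra $\langle\mathfrak{B},\mathsf{C}_{\mathbf{d}}\rangle$ satisfies the generalized interpolation axiom: for every $Y\subseteq B$ and every $x\in B$, if $x\ll_{\mathbf{d}} y$ for all $y\in Y$, then there is $z\in B$ with $x\ll_{\mathbf{d}} z$ and $z\ll_{\mathbf{d}} y$ for all $y\in Y$.
   Context: $x\ll_{\mathbf{d}} y$ means $\neg(x\mathrel{\mathsf{C}_{\mathbf{d}}} -y)$. *)

theory Defs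
  imports Main
begin

(* A contact algebra is a Boolean algebra with a relation C; the Boolean algebra is the type 'a. *)
locale contact_algebra =
  fixes C :: "'a::boolean_algebra \<Rightarrow> 'a \<Rightarrow> bool"
  assumes not_bot: "\<not> C bot x"
    and le_contact: "x \<le> y \<Longrightarrow> x \<noteq> bot \<Longrightarrow> C x y"
    and sym: "C x y \<Longrightarrow> C y x"
    and mono: "x \<le> y \<Longrightarrow> C z x \<Longrightarrow> C z y"
    and sup_split: "C x (sup y z) \<Longrightarrow> C x y \<or> C x z"

definition nontangential_part :: "('a::boolean_algebra \<Rightarrow> 'a \<Rightarrow> bool) \<Rightarrow> 'a \<Rightarrow> 'a \<Rightarrow> bool" where
  "nontangential_part C x y \<longleftrightarrow> \<not> C x (- y)"

definition generalized_interpolation :: "('a::boolean_algebra \<Rightarrow> 'a \<Rightarrow> bool) \<Rightarrow> bool" where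
  "generalized_interpolation C \<longleftrightarrow>
    (\<forall>Y x. (\<forall>y\<in>Y. nontangential_part C x y) \<longrightarrow>
      (\<exists>z. nontangential_part C x z \<and> (\<forall>y\<in>Y. nontangential_part C z y)))"

definition contact_of :: "'a::boolean_algebra \<Rightarrow> 'a \<Rightarrow> 'a \<Rightarrow> bool" where
  "contact_of d x y \<longleftrightarrow> inf x y \<noteq> bot \<or> (inf x d \<noteq> bot \<and> inf y d \<noteq> bot)"

end

(* x \<lless> y holds iff x \<le> y and either x is disjoint from d or d \<le> y. If x is
   disjoint from d then x \<lless> x, so x itself interpolates; otherwise every y in Y lies above
   both x and d, and the join of x and d interpolates. *)
theory Submission
  imports Defs
begin

lemma contact_algebra_contact_of: "contact_algebra (contact_of d)"
proof
  fix x y z :: 'a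
  show "\<not> contact_of d bot x"
    by (simp add: contact_of_def)
  show "x \<le> y \<Longrightarrow> x \<noteq> bot \<Longrightarrow> contact_of d x y"
    by (simp add: contact_of_def inf_absorb1)
  show "contact_of d x y \<Longrightarrow> contact_of d y x"
    by (auto simp: contact_of_def inf_commute)
  show "x \<le> y \<Longrightarrow> contact_of d z x \<Longrightarrow> contact_of d z y"
    \<comment> \<open>Contrapositively, a meet with \<open>y\<close> equal to \<open>bot\<close>
      forces the smaller meet with \<open>x\<close> to be \<open>bot\<close>.\<close>
    unfolding contact_of_def by (metis bot_unique inf_mono order_refl)
  show "contact_of d x (sup y z) \<Longrightarrow> contact_of d x y \<or> contact_of d x z"
    by (auto simp: contact_of_def inf_sup_distrib1 inf_sup_distrib2)
qed

text \<open>Negating contact of \<open>x\<close> with \<open>- y\<close> makes \<open>x\<close>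
  disjoint from \<open>- y\<close> and one of \<open>x\<close>, \<open>- y\<close> disjoint from
  \<open>d\<close>. By \<open>inf_shunt\<close>, being disjoint from \<open>- y\<close> means lying
  below \<open>- (- y)\<close>, which is \<open>y\<close>.\<close>

lemma nontangential_part_contact_of_iff:
  "nontangential_part (contact_of d) x y \<longleftrightarrow> x \<le> y \<and> (inf x d = bot \<or> d \<le> y)"
  using inf_shunt[of d "- y"]
  by (auto simp: nontangential_part_def contact_of_def inf_shunt[of x "- y"] inf_commute)

lemma generalized_interpolation_contact_of: "generalized_interpolation (contact_of d)"
  unfolding generalized_interpolation_def nontangential_part_contact_of_iff
proof (intro allI impI)
  fix Y x
  assume "\<forall>y\<in>Y. x \<le> y \<and> (inf x d = bot \<or> d \<le> y)"
  then show "\<exists>z. (x \<le> z \<and> (inf x d = bot \<or> d \<le> z)) \<and>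
      (\<forall>y\<in>Y. z \<le> y \<and> (inf z d = bot \<or> d \<le> y))"
    by (intro exI[of _ "if inf x d = bot then x else sup x d"]) auto
qed

theorem theorem6p2:
  fixes d :: "'a::boolean_algebra"
  assumes "d \<noteq> bot"
  shows "contact_algebra (contact_of d) \<and> generalized_interpolation (contact_of d)"
  by (simp add: contact_algebra_contact_of generalized_interpolation_contact_of)

end
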